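(* The sequence $(s(n))_{n=1}^\infty$ of little Schröder numbers, given by $$s(n)=\sum_{k=1}^{n}N(n,k)\,2^{k-1},\qquad N(n,k)=\frac{1}{n}\binom{n}{k}\binom{n}{k-1},$$ is not almost realizable.
   Context: A sequence $a=(a(n))_{n=1}^\infty$ of non-negative integers is called realizable if one of the following two equivalent conditions holds: (1) there is a self-map $T:X\to X$ on a set $X$ such that $a(n)=\#\{x\in X: T^n(x)=x\}$ for all $n\ge 1$; (2) for all $n\ge 1$, $(\mu*a)(n)=\sum_{d\mid n}\mu(n/d)\,a(d)$ is a non-negative integer divisible by $n$, where $\mu$ is the classical Möbius function and $*$ is Dirichlet convolution. The sequence $a$ is called almost realizable if there exists a positive integer $m$ such that $(m\,a(n))_{n=1}^\infty$ is realizable. The numbers $N(n,k)$ (Narayana numbers) are positive integers for $1\le k\le n$. *)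

theory Defs
  imports Complex_Main "HOL-Computational_Algebra.Computational_Algebra"
begin

definition moebius_mu :: "nat \<Rightarrow> int" where
  "moebius_mu n = (if squarefree n then (- 1) ^ card (prime_factors n) else 0)"

definition dirichlet_conv :: "(nat \<Rightarrow> int) \<Rightarrow> (nat \<Rightarrow> int) \<Rightarrow> nat \<Rightarrow> int" where
  "dirichlet_conv f g n = (\<Sum>d | d dvd n. f (n div d) * g d)"

(* Sequences indexed by n >= 1 are functions on nat; the value at 0 is irrelevant. Realizability
   is taken in its arithmetic form, which is equivalent to a(n) being the number of fixed
   points of the n-th iterate of a self-map of some set. *)
definition realizable :: "(nat \<Rightarrow> nat) \<Rightarrow> bool" where
  "realizable a \<longleftrightarrow>
     (\<forall>n\<ge>1. dirichlet_conv moebius_mu (\<lambda>d. int (a d)) n \<ge> 0 \<and>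
            int n dvd dirichlet_conv moebius_mu (\<lambda>d. int (a d)) n)"

definition almost_realizable :: "(nat \<Rightarrow> nat) \<Rightarrow> bool" where
  "almost_realizable a \<longleftrightarrow> (\<exists>m\<ge>1. realizable (\<lambda>n. m * a n))"

(* The division is exact for 1 <= k <= n, see of_nat_narayana below. *)
definition narayana :: "nat \<Rightarrow> nat \<Rightarrow> nat" where
  "narayana n k = ((n choose k) * (n choose (k - 1))) div n"

definition little_schroeder :: "nat \<Rightarrow> nat" where
  "little_schroeder n = (\<Sum>k=1..n. narayana n k * 2 ^ (k - 1))"

lemma narayana_dvd:
  assumes "1 \<le> k" "k \<le> n"
  shows "n dvd (n choose k) * (n choose (k - 1))"
proof -
  obtain j where k: "k = Suc j" using assms(1) by (cases k) auto
  obtain m where n: "n = Suc m" using assms by (cases n) auto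
  define X where "X = (n choose k) * (n choose j)"
  have "Suc j * X = n * ((m choose j) * (n choose j))"
    using Suc_times_binomial_eq[of m j] unfolding X_def k n
    by (metis mult.assoc mult.commute)
  hence 1: "n dvd Suc j * X" by simp
  have "(n - j) * X = n * ((m choose j) * (n choose k))"
    using binomial_absorb_comp[of n j] unfolding X_def n
    by (metis diff_Suc_1 mult.assoc mult.commute)
  hence 2: "n dvd (n - j) * X" by simp
  have "Suc j * X + (n - j) * X = n * X + X"
    using assms(2) k by (simp add: algebra_simps flip: add_mult_distrib)
  with 1 2 have "n dvd n * X + X" by (metis dvd_add)
  hence "n dvd X" by (metis dvd_add_right_iff dvd_triv_left)
  thus ?thesis by (simp add: X_def k)
qed

lemma of_nat_narayana:
  assumes "1 \<le> k" "k \<le> n"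
  shows "real (narayana n k) = 1 / real n * real (n choose k) * real (n choose (k - 1))"
  using narayana_dvd[OF assms] by (simp add: narayana_def real_of_nat_div)

end

theory Submission
  imports Defs "HOL-Number_Theory.Residues"
begin

text \<open>
  For an odd prime \<open>p\<close> only the terms \<open>k = 1\<close> and \<open>k = p\<close> of the sum defining \<open>s(p)\<close> survive
  modulo \<open>p\<close>, so \<open>s(p) \<equiv> 1 + 2 ^ (p - 1) \<equiv> 2\<close> by Fermat, whereas \<open>s(1) = 1\<close>. Realizability of
  \<open>m \<cdot> s\<close> at \<open>p\<close> means \<open>p dvd m * (s(p) - s(1))\<close>, hence \<open>p dvd m\<close>; this fails for \<open>p > m\<close>.
\<close>

lemma dirichlet_conv_moebius_mu_prime:
  assumes "prime p"
  shows "dirichlet_conv moebius_mu f p = f p - f 1"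
proof -
  have "{d. d dvd p} = {1, p}"
    using assms by (auto simp: prime_nat_iff)
  moreover have "p \<noteq> 1" "p > 0"
    using assms prime_gt_1_nat[of p] by auto
  ultimately show ?thesis
    using assms
    by (simp add: dirichlet_conv_def moebius_mu_def squarefree_prime prime_prime_factors)
qed

text \<open>Since \<open>1 \<le> k - 1\<close> and \<open>k < p\<close>, both binomial coefficients
  are multiples of \<open>p\<close>; their product contains \<open>p * p\<close>, so one factor
  \<open>p\<close> survives the division by \<open>p\<close>.\<close>

lemma prime_dvd_narayana:
  assumes "prime p" "2 \<le> k" "k < p"
  shows "p dvd narayana p k"
proof -
  have "p dvd p choose k" "p dvd p choose (k - 1)"
    using assms by (auto intro!: dvd_choose_prime)
  moreover from this have "p * p dvd (p choose k) * (p choose (k - 1))"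
    by (rule mult_dvd_mono)
  ultimately show ?thesis
    using prime_gt_0_nat[OF \<open>prime p\<close>]
    by (simp add: narayana_def dvd_div_iff_mult)
qed

lemma little_schroeder_1 [simp]: "little_schroeder (Suc 0) = 1"
  by (simp add: little_schroeder_def narayana_def)

lemma little_schroeder_prime_cong:
  assumes "prime p" "p > 2"
  shows "[little_schroeder p = 2] (mod p)"
proof -
  let ?t = "\<lambda>k. narayana p k * 2 ^ (k - 1)"
  \<comment> \<open>At both end terms one binomial coefficient is 1 and the other is
    \<open>p\<close>, so the division by \<open>p\<close> leaves Narayana number 1.\<close>
  have "{1..p} = insert 1 (insert p {2..<p})"
    using \<open>p > 2\<close> by auto
  hence "little_schroeder p = ?t 1 + (?t p + (\<Sum>k=2..<p. ?t k))"
    using \<open>p > 2\<close> by (simp add: little_schroeder_def)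
  moreover have "p choose (p - 1) = p"
    using binomial_symmetric[of 1 p] \<open>p > 2\<close> by simp
  hence "?t 1 = 1" "?t p = 2 ^ (p - 1)"
    using \<open>p > 2\<close> by (simp_all add: narayana_def)
  moreover have "[(\<Sum>k=2..<p. ?t k) = 0] (mod p)"
    using prime_dvd_narayana[OF \<open>prime p\<close>] by (auto simp: cong_0_iff intro!: dvd_sum)
  moreover have "[2 ^ (p - 1) = 1] (mod p)"
    using fermat_theorem[OF \<open>prime p\<close>, of 2] \<open>p > 2\<close> nat_dvd_not_less[of 2 p] by simp
  ultimately have "[little_schroeder p = 1 + (1 + 0)] (mod p)"
    by (auto simp only: intro!: cong_add cong_refl)
  thus ?thesis by (simp add: numeral_2_eq_2)
qed

theorem mainTheorem6:
  shows "\<not> almost_realizable little_schroeder"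
proof
  assume "almost_realizable little_schroeder"
  then obtain m where m: "m \<ge> 1" "realizable (\<lambda>n. m * little_schroeder n)"
    by (auto simp: almost_realizable_def)
  \<comment> \<open>\<open>p > m\<close> excludes \<open>p dvd m\<close>, while \<open>p > 2\<close>
    makes 2 invertible modulo \<open>p\<close>, as Fermat requires.\<close>
  obtain p where p: "prime p" "p > max m 2"
    using bigger_prime by blast
  let ?s = "int (little_schroeder p)"
  have "int p dvd dirichlet_conv moebius_mu (\<lambda>d. int (m * little_schroeder d)) p"
    using m(2) p(2) by (simp add: realizable_def)
  hence "int p dvd int m * (?s - 1)"
    by (simp add: dirichlet_conv_moebius_mu_prime[OF p(1)] right_diff_distrib)
  moreover have "\<not> int p dvd int m"
    using m(1) p(2) by (auto dest: dvd_imp_le)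
  ultimately have "int p dvd ?s - 1"
    using p(1) by (simp add: prime_dvd_mult_iff)
  moreover have "int p dvd ?s - 2"
    using little_schroeder_prime_cong[of p] p cong_int_iff[of "little_schroeder p" 2 p]
    by (simp add: cong_iff_dvd_diff)
  \<comment> \<open>This difference is 1, which no prime divides.\<close>
  ultimately have "int p dvd (?s - 1) - (?s - 2)"
    by (rule dvd_diff)
  thus False
    using p(2) by simp
qed

end
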